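(* Let $\mathbf{k}$ be a unitary commutative ring. Every connected filtered left counital operated bialgebra $H=(H,m,\mu,\Delta,\varepsilon,P)$ over $\mathbf{k}$ is a left counital Hopf algebra. A right antipode $S:H\to H$ is recursively defined by $$S(1_H)=1_H,\qquad S(x)=-\sum_{x}x'S(x'')\quad\text{for } x\in\ker\varepsilon,$$ where $\tilde\Delta(x):=\Delta(x)-1_H\otimes x$ is written in Sweedler's notation as $\tilde\Delta(x)=\sum_x x'\otimes x''$.
   Context: All algebras are unitary, commutative and associative over $\mathbf{k}$; algebra homomorphisms preserve units; tensor products and linear maps are over $\mathbf{k}$. A left counital operated bialgebra is $(H,m,\mu,\Delta,\varepsilon,P)$ where $(H,m,\mu)$ is an algebra with unit map $\mu:\mathbf{k}\to H$, $P:H\to H$ is a linear operator, $\Delta:H\to H\otimes H$ is a coassociative linear map, $\varepsilon:H\to\mathbf{k}$ is linear and left counital, i.e. $(\varepsilon\otimes\mathrm{id})\Delta(x)=1\otimes x$ for all $x\in H$ (no right counitality is assumed), and $\Delta$ and $\varepsilon$ are algebra homomorphisms. It is filtered if there is an increasing filtration $H^0\subseteq H^1\subseteq\cdots$ of $H$ by submodules such that $\bigcup_{n\ge0}H^n=H$, $H^pH^q\subseteq H^{p+q}$, and $$\Delta(H^n)\subseteq H^0\otimes H^n+\sum_{p+q=n,\;p>0,\,q>0}H^p\otimes H^q$$ for all $n\geq 0$ (the tensor products on the right being understood as their images in $H\otimes H$). A filtered one is connected if $H^0=\operatorname{im}\mu=\mathbf{k}1_H$. The convolution product of linear maps $f,g:H\to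 H$ is $f\ast g=m(f\otimes g)\Delta$, and $e:=\mu\varepsilon$. A right antipode is a linear map $S:H\to H$ with $\mathrm{id}_H\ast S=e$. A left counital Hopf algebra is a left counital operated bialgebra that has a right antipode. *)

theory Defs
  imports "HOL-Algebra.Free_Abelian_Groups" "HOL-Algebra.AbelCoset" "HOL-Algebra.Module"
begin

section \<open>Linear maps\<close>

definition linear_maps ::
  "('r, 's) ring_scheme \<Rightarrow> ('r, 'a, 'm) module_scheme \<Rightarrow> ('r, 'b, 'n) module_scheme \<Rightarrow> ('a \<Rightarrow> 'b) set"
  where "linear_maps R M N =
    {f. f \<in> carrier M \<rightarrow> carrier N \<and>
        (\<forall>x\<in>carrier M. \<forall>y\<in>carrier M. f (x \<oplus>\<^bsub>M\<^esub> y) = f x \<oplus>\<^bsub>N\<^esub> f y) \<and>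
        (\<forall>r\<in>carrier R. \<forall>x\<in>carrier M. f (r \<odot>\<^bsub>M\<^esub> x) = r \<odot>\<^bsub>N\<^esub> f x)}"

definition regular_module :: "('r, 's) ring_scheme \<Rightarrow> ('r, 'r) module"
  where "regular_module R =
    \<lparr>carrier = carrier R, mult = mult R, one = \<one>\<^bsub>R\<^esub>, ring.zero = \<zero>\<^bsub>R\<^esub>, add = add R, smult = mult R\<rparr>"

section \<open>Tensor products over a commutative ring\<close>

text \<open>The tensor product of the modules \<open>M\<close> and \<open>N\<close> over \<open>R\<close> is the free abelian group on the
  pairs of elements, divided by the subgroup generated by the relations of biadditivity and
  balancedness.  Its elements are cosets.\<close>

definition tensor_relations ::
  "('r, 's) ring_scheme \<Rightarrow> ('r, 'a, 'm) module_scheme \<Rightarrow> ('r, 'b, 'n) module_scheme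
    \<Rightarrow> ('a \<times> 'b \<Rightarrow>\<^sub>0 int) set"
  where "tensor_relations R M N =
     {frag_of (a \<oplus>\<^bsub>M\<^esub> a', b) - frag_of (a, b) - frag_of (a', b) | a a' b.
        a \<in> carrier M \<and> a' \<in> carrier M \<and> b \<in> carrier N}
   \<union> {frag_of (a, b \<oplus>\<^bsub>N\<^esub> b') - frag_of (a, b) - frag_of (a, b') | a b b'.
        a \<in> carrier M \<and> b \<in> carrier N \<and> b' \<in> carrier N}
   \<union> {frag_of (r \<odot>\<^bsub>M\<^esub> a, b) - frag_of (a, r \<odot>\<^bsub>N\<^esub> b) | r a b.
        r \<in> carrier R \<and> a \<in> carrier M \<and> b \<in> carrier N}"

definition tensor_null ::
  "('r, 's) ring_scheme \<Rightarrow> ('r, 'a, 'm) module_scheme \<Rightarrow> ('r, 'b, 'n) module_scheme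
    \<Rightarrow> ('a \<times> 'b \<Rightarrow>\<^sub>0 int) set"
  where "tensor_null R M N =
    generate (free_Abelian_group (carrier M \<times> carrier N)) (tensor_relations R M N)"

definition tensor_group ::
  "('r, 's) ring_scheme \<Rightarrow> ('r, 'a, 'm) module_scheme \<Rightarrow> ('r, 'b, 'n) module_scheme
    \<Rightarrow> ('a \<times> 'b \<Rightarrow>\<^sub>0 int) set monoid"
  where "tensor_group R M N =
    free_Abelian_group (carrier M \<times> carrier N) Mod tensor_null R M N"

definition pure_tensor ::
  "('r, 's) ring_scheme \<Rightarrow> ('r, 'a, 'm) module_scheme \<Rightarrow> ('r, 'b, 'n) module_scheme
    \<Rightarrow> 'a \<Rightarrow> 'b \<Rightarrow> ('a \<times> 'b \<Rightarrow>\<^sub>0 int) set"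
  where "pure_tensor R M N a b =
    tensor_null R M N #>\<^bsub>free_Abelian_group (carrier M \<times> carrier N)\<^esub> frag_of (a, b)"

text \<open>\<open>tensor_lift G f\<close> is the homomorphism into the abelian group \<open>G\<close> (written multiplicatively)
  that sends the pure tensor of \<open>a\<close> and \<open>b\<close> to \<open>f a b\<close>.  It evaluates the formal sums in a coset;
  for biadditive balanced \<open>f\<close> they all have the same value.\<close>

definition tensor_lift ::
  "('c, 'q) monoid_scheme \<Rightarrow> ('a \<Rightarrow> 'b \<Rightarrow> 'c) \<Rightarrow> ('a \<times> 'b \<Rightarrow>\<^sub>0 int) set \<Rightarrow> 'c"
  where "tensor_lift G f z =
    the_elem ((\<lambda>u. finprod G (\<lambda>(a, b). f a b [^]\<^bsub>G\<^esub> Poly_Mapping.lookup u (a, b))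
                      (Poly_Mapping.keys u)) ` z)"

text \<open>The components \<open>mult\<close> and \<open>one\<close> are meaningful only when \<open>M\<close> and \<open>N\<close> are algebras.\<close>

definition tensor_product ::
  "('r, 's) ring_scheme \<Rightarrow> ('r, 'a, 'm) module_scheme \<Rightarrow> ('r, 'b, 'n) module_scheme
    \<Rightarrow> ('r, ('a \<times> 'b \<Rightarrow>\<^sub>0 int) set) module"
  where "tensor_product R M N =
    \<lparr>carrier = carrier (tensor_group R M N),
     mult = (\<lambda>z w. tensor_lift (tensor_group R M N)
               (\<lambda>a b. tensor_lift (tensor_group R M N)
                        (\<lambda>c d. pure_tensor R M N (a \<otimes>\<^bsub>M\<^esub> c) (b \<otimes>\<^bsub>N\<^esub> d)) w) z),
     one = pure_tensor R M N \<one>\<^bsub>M\<^esub> \<one>\<^bsub>N\<^esub>,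
     ring.zero = \<one>\<^bsub>tensor_group R M N\<^esub>,
     add = mult (tensor_group R M N),
     smult = (\<lambda>r. tensor_lift (tensor_group R M N) (\<lambda>a b. pure_tensor R M N (r \<odot>\<^bsub>M\<^esub> a) b))\<rparr>"

text \<open>\<open>tensor_map R M N f g\<close> is the tensor product of \<open>f\<close> and \<open>g\<close>, where \<open>M\<close> and \<open>N\<close> are the
  codomains of \<open>f\<close> and \<open>g\<close>.\<close>

definition tensor_map ::
  "('r, 's) ring_scheme \<Rightarrow> ('r, 'c, 'm) module_scheme \<Rightarrow> ('r, 'd, 'n) module_scheme
    \<Rightarrow> ('a \<Rightarrow> 'c) \<Rightarrow> ('b \<Rightarrow> 'd) \<Rightarrow> ('a \<times> 'b \<Rightarrow>\<^sub>0 int) set \<Rightarrow> ('c \<times> 'd \<Rightarrow>\<^sub>0 int) set"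
  where "tensor_map R M N f g =
    tensor_lift (add_monoid (tensor_product R M N)) (\<lambda>a b. pure_tensor R M N (f a) (g b))"

definition tensor_assoc ::
  "('r, 's) ring_scheme \<Rightarrow> ('r, 'a, 'l) module_scheme \<Rightarrow> ('r, 'b, 'm) module_scheme
    \<Rightarrow> ('r, 'c, 'n) module_scheme
    \<Rightarrow> (('a \<times> 'b \<Rightarrow>\<^sub>0 int) set \<times> 'c \<Rightarrow>\<^sub>0 int) set \<Rightarrow> ('a \<times> ('b \<times> 'c \<Rightarrow>\<^sub>0 int) set \<Rightarrow>\<^sub>0 int) set"
  where "tensor_assoc R L M N =
    (let T = add_monoid (tensor_product R L (tensor_product R M N))
     in tensor_lift T (\<lambda>t c. tensor_lift T
          (\<lambda>a b. pure_tensor R L (tensor_product R M N) a (pure_tensor R M N b c)) t))"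

text \<open>The image of \<open>A \<otimes> B\<close> in \<open>M \<otimes> N\<close>, for submodules \<open>A\<close> of \<open>M\<close> and \<open>B\<close> of \<open>N\<close>; the canonical
  map need not be injective.\<close>

definition tensor_image ::
  "('r, 's) ring_scheme \<Rightarrow> ('r, 'a, 'm) module_scheme \<Rightarrow> ('r, 'b, 'n) module_scheme
    \<Rightarrow> 'a set \<Rightarrow> 'b set \<Rightarrow> ('a \<times> 'b \<Rightarrow>\<^sub>0 int) set set"
  where "tensor_image R M N A B =
    tensor_map R M N (\<lambda>a. a) (\<lambda>b. b) `
      carrier (tensor_product R (M\<lparr>carrier := A\<rparr>) (N\<lparr>carrier := B\<rparr>))"

section \<open>Left counital operated bialgebras\<close>

definition mult_map :: "('r, 'a, 'm) module_scheme \<Rightarrow> ('a \<times> 'a \<Rightarrow>\<^sub>0 int) set \<Rightarrow> 'a"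
  where "mult_map H = tensor_lift (add_monoid H) (\<lambda>a b. a \<otimes>\<^bsub>H\<^esub> b)"

definition unit_map :: "('r, 'a, 'm) module_scheme \<Rightarrow> 'r \<Rightarrow> 'a"
  where "unit_map H r = r \<odot>\<^bsub>H\<^esub> \<one>\<^bsub>H\<^esub>"

locale left_counital_operated_bialgebra = algebra R H
  for R :: "('r, 's) ring_scheme" (structure) and H :: "('r, 'a, 'm) module_scheme" (structure) +
  fixes \<Delta> :: "'a \<Rightarrow> ('a \<times> 'a \<Rightarrow>\<^sub>0 int) set"
    and \<epsilon> :: "'a \<Rightarrow> 'r"
    and P :: "'a \<Rightarrow> 'a"
  assumes operator_linear: "P \<in> linear_maps R H H"
    and coproduct_linear: "\<Delta> \<in> linear_maps R H (tensor_product R H H)"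
    and coproduct_hom: "\<Delta> \<in> ring_hom H (tensor_product R H H)"
    and coassociative: "\<And>x. x \<in> carrier H \<Longrightarrow>
      tensor_assoc R H H H (tensor_map R (tensor_product R H H) H \<Delta> (\<lambda>y. y) (\<Delta> x))
        = tensor_map R H (tensor_product R H H) (\<lambda>y. y) \<Delta> (\<Delta> x)"
    and counit_linear: "\<epsilon> \<in> linear_maps R H (regular_module R)"
    and counit_hom: "\<epsilon> \<in> ring_hom H R"
    and left_counital: "\<And>x. x \<in> carrier H \<Longrightarrow>
      tensor_map R (regular_module R) H \<epsilon> (\<lambda>y. y) (\<Delta> x) = pure_tensor R (regular_module R) H \<one>\<^bsub>R\<^esub> x"

locale filtered_left_counital_operated_bialgebra =
  left_counital_operated_bialgebra R H \<Delta> \<epsilon> P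
  for R :: "('r, 's) ring_scheme" (structure) and H :: "('r, 'a, 'm) module_scheme" (structure)
    and \<Delta> \<epsilon> P +
  fixes F :: "nat \<Rightarrow> 'a set"
  assumes filtration_submodule: "\<And>n. submodule (F n) R H"
    and filtration_mono: "\<And>n. F n \<subseteq> F (Suc n)"
    and filtration_exhaustive: "(\<Union>n. F n) = carrier H"
    and filtration_mult: "\<And>p q x y. x \<in> F p \<Longrightarrow> y \<in> F q \<Longrightarrow> x \<otimes>\<^bsub>H\<^esub> y \<in> F (p + q)"
    and filtration_coproduct: "\<And>n. \<Delta> ` F n \<subseteq>
      tensor_image R H H (F 0) (F n) <+>\<^bsub>tensor_product R H H\<^esub>
        {\<Oplus>\<^bsub>tensor_product R H H\<^esub>p\<in>{0<..<n}. t p | t.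
           t \<in> (\<Pi> p\<in>{0<..<n}. tensor_image R H H (F p) (F (n - p)))}"

locale connected_filtered_left_counital_operated_bialgebra =
  filtered_left_counital_operated_bialgebra R H \<Delta> \<epsilon> P F
  for R :: "('r, 's) ring_scheme" (structure) and H :: "('r, 'a, 'm) module_scheme" (structure)
    and \<Delta> \<epsilon> P F +
  assumes connected: "F 0 = unit_map H ` carrier R"

section \<open>Right antipodes\<close>

definition convolution ::
  "('r, 's) ring_scheme \<Rightarrow> ('r, 'a, 'm) module_scheme \<Rightarrow> ('a \<Rightarrow> ('a \<times> 'a \<Rightarrow>\<^sub>0 int) set)
    \<Rightarrow> ('a \<Rightarrow> 'a) \<Rightarrow> ('a \<Rightarrow> 'a) \<Rightarrow> 'a \<Rightarrow> 'a"
  where "convolution R H \<Delta> f g x = mult_map H (tensor_map R H H f g (\<Delta> x))"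

definition right_antipode ::
  "('r, 's) ring_scheme \<Rightarrow> ('r, 'a, 'm) module_scheme \<Rightarrow> ('a \<Rightarrow> ('a \<times> 'a \<Rightarrow>\<^sub>0 int) set)
    \<Rightarrow> ('a \<Rightarrow> 'r) \<Rightarrow> ('a \<Rightarrow> 'a) \<Rightarrow> bool"
  where "right_antipode R H \<Delta> \<epsilon> S \<longleftrightarrow>
    S \<in> linear_maps R H H \<and>
    (\<forall>x\<in>carrier H. convolution R H \<Delta> (\<lambda>y. y) S x = unit_map H (\<epsilon> x))"

definition left_counital_Hopf_algebra ::
  "('r, 's) ring_scheme \<Rightarrow> ('r, 'a, 'm) module_scheme \<Rightarrow> ('a \<Rightarrow> ('a \<times> 'a \<Rightarrow>\<^sub>0 int) set)
    \<Rightarrow> ('a \<Rightarrow> 'r) \<Rightarrow> ('a \<Rightarrow> 'a) \<Rightarrow> bool"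
  where "left_counital_Hopf_algebra R H \<Delta> \<epsilon> P \<longleftrightarrow>
    left_counital_operated_bialgebra R H \<Delta> \<epsilon> P \<and> (\<exists>S. right_antipode R H \<Delta> \<epsilon> S)"

definition reduced_coproduct ::
  "('r, 's) ring_scheme \<Rightarrow> ('r, 'a, 'm) module_scheme \<Rightarrow> ('a \<Rightarrow> ('a \<times> 'a \<Rightarrow>\<^sub>0 int) set)
    \<Rightarrow> 'a \<Rightarrow> ('a \<times> 'a \<Rightarrow>\<^sub>0 int) set"
  where "reduced_coproduct R H \<Delta> x =
    \<Delta> x \<ominus>\<^bsub>tensor_product R H H\<^esub> pure_tensor R H H \<one>\<^bsub>H\<^esub> x"

text \<open>In Sweedler's notation, \<open>tensor_lift (add_monoid H) (\<lambda>a b. a \<otimes> S b) (reduced_coproduct R H \<Delta> x)\<close>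
  is the sum of the products \<open>x' \<otimes> S x''\<close>.\<close>

definition antipode_recursion ::
  "('r, 's) ring_scheme \<Rightarrow> ('r, 'a, 'm) module_scheme \<Rightarrow> ('a \<Rightarrow> ('a \<times> 'a \<Rightarrow>\<^sub>0 int) set)
    \<Rightarrow> ('a \<Rightarrow> 'r) \<Rightarrow> ('a \<Rightarrow> 'a) \<Rightarrow> bool"
  where "antipode_recursion R H \<Delta> \<epsilon> S \<longleftrightarrow>
    S \<one>\<^bsub>H\<^esub> = \<one>\<^bsub>H\<^esub> \<and>
    (\<forall>x\<in>a_kernel H R \<epsilon>.
       S x = \<ominus>\<^bsub>H\<^esub> tensor_lift (add_monoid H) (\<lambda>a b. a \<otimes>\<^bsub>H\<^esub> S b) (reduced_coproduct R H \<Delta> x))"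

end

theory Submission
  imports Defs
begin

text \<open>For \<open>x \<in> F n\<close> connectedness gives \<open>\<Delta> x = 1 \<otimes> y + v\<close>, where \<open>v\<close> is a sum of tensors whose right
  factors have filtration degree less than \<open>n\<close>.  Applying \<open>a \<otimes> b \<mapsto> \<epsilon> a \<cdot> b\<close>, left counitality yields
  \<open>x = y + (\<epsilon> \<otimes> id) v\<close>, so \<open>\<Delta> x - 1 \<otimes> x = v - 1 \<otimes> (\<epsilon> \<otimes> id) v\<close> also has right factors of lower degree.
  Hence the equation \<open>S x = \<epsilon> x \<cdot> 1 - \<Sum> x' S x''\<close>, which for linear \<open>S\<close> is equivalent both to the recursion
  and to \<open>id * S = e\<close>, determines \<open>S\<close> on \<open>F n\<close> from its values in lower degrees.  Iterating its right-hand
  side from the zero map keeps every approximation linear, and the approximations stabilise on each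
  \<open>F n\<close>, so the limit is linear.\<close>

section \<open>Universal property of the tensor product\<close>

lemma abelian_group_homI:
  assumes A: "abelian_group A" and B: "abelian_group B"
    and "\<And>x. x \<in> carrier A \<Longrightarrow> f x \<in> carrier B"
    and "\<And>x y. x \<in> carrier A \<Longrightarrow> y \<in> carrier A \<Longrightarrow> f (x \<oplus>\<^bsub>A\<^esub> y) = f x \<oplus>\<^bsub>B\<^esub> f y"
  shows "abelian_group_hom A B f"
proof -
  have "f \<in> hom (add_monoid A) (add_monoid B)"
    using assms(3,4) by (intro homI) auto
  then show ?thesis
    using abelian_group.a_group[OF A] abelian_group.a_group[OF B] A B
    by (simp add: abelian_group_hom_def abelian_group_hom_axioms_def group_hom_def group_hom_axioms_def)
qed

lemma abelian_group_hom_compose: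
  assumes f: "abelian_group_hom A B f" and g: "abelian_group_hom B C g"
  shows "abelian_group_hom A C (\<lambda>x. g (f x))"
proof -
  interpret f: abelian_group_hom A B f by fact
  interpret g: abelian_group_hom B C g by fact
  show ?thesis
    by (intro abelian_group_homI f.G.abelian_group_axioms g.H.abelian_group_axioms) auto
qed

lemma abelian_group_hom_finsum_cong:
  assumes f: "abelian_group_hom A B f" and g: "abelian_group_hom A B g"
    and I: "finite I" "t \<in> I \<rightarrow> carrier A" "\<And>i. i \<in> I \<Longrightarrow> f (t i) = g (t i)"
  shows "f (\<Oplus>\<^bsub>A\<^esub>i\<in>I. t i) = g (\<Oplus>\<^bsub>A\<^esub>i\<in>I. t i)"
proof -
  interpret f: abelian_group_hom A B f by fact
  interpret g: abelian_group_hom A B g by fact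
  from I show ?thesis
  proof (induction I rule: finite_induct)
    case (insert i I)
    then have "finsum A t I \<in> carrier A"
      by (auto intro: f.G.finsum_closed)
    with insert show ?case
      by (auto simp: Pi_iff)
  qed simp
qed

section \<open>Evaluation of formal integer sums in an abelian group\<close>

lemma (in abelian_group) add_diff_cancel:
  assumes xy: "x \<in> carrier G" "y \<in> carrier G"
  shows "x \<oplus> y \<oplus> \<ominus> x \<oplus> \<ominus> y = \<zero>"
proof -
  have "x \<oplus> y \<oplus> \<ominus> x = y \<oplus> x \<oplus> \<ominus> x"
    using xy by (simp only: a_comm)
  also have "\<dots> = y"
    using xy by (simp add: a_assoc r_neg)
  finally show ?thesis
    using xy by (simp add: r_neg)
qed

text \<open>This is the universal property of the free abelian group: \<open>f\<close> on the basis
  extends to formal sums. The products for \<open>u\<close>, \<open>v\<close> and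
  \<open>u + v\<close> run over different supports; all are extended to the union \<open>?K\<close>,
  where the additional exponents are 0, and then compared factor by factor.\<close>

lemma (in comm_group) finprod_pow_lookup_hom:
  assumes f: "f \<in> B \<rightarrow> carrier G"
  shows "(\<lambda>u :: 'c \<Rightarrow>\<^sub>0 int. \<Otimes>x\<in>Poly_Mapping.keys u. f x [^] Poly_Mapping.lookup u x) \<in> hom (free_Abelian_group B) G"
    (is "?h \<in> _")
proof (rule homI)
  fix u assume "u \<in> carrier (free_Abelian_group B)"
  with f show "?h u \<in> carrier G"
    by (auto intro!: finprod_closed int_pow_closed)
next
  fix u v assume uv: "u \<in> carrier (free_Abelian_group B)" "v \<in> carrier (free_Abelian_group B)"
  let ?K = "Poly_Mapping.keys u \<union> Poly_Mapping.keys v"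
  have fK: "f x \<in> carrier G" if "x \<in> ?K" for x
    using that uv f by auto
  have ext: "?h w = (\<Otimes>x\<in>?K. f x [^] Poly_Mapping.lookup w x)"
    if "Poly_Mapping.keys w \<subseteq> ?K" for w
    using that fK
    by (intro finprod_mono_neutral_cong_left) (auto simp: in_keys_iff)
  have "?h (u + v) = (\<Otimes>x\<in>?K. f x [^] Poly_Mapping.lookup u x \<otimes> f x [^] Poly_Mapping.lookup v x)"
    using fK by (subst ext[OF keys_add], intro finprod_cong')
      (auto simp: Poly_Mapping.lookup_add int_pow_mult)
  also have "\<dots> = ?h u \<otimes> ?h v"
    using fK by (subst finprod_multf) (auto simp: ext)
  finally show "?h (u \<otimes>\<^bsub>free_Abelian_group B\<^esub> v) = ?h u \<otimes> ?h v"
    by simp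
qed

lemma (in comm_group) finprod_pow_lookup_frag_of:
  "f x \<in> carrier G \<Longrightarrow>
    (\<Otimes>y\<in>Poly_Mapping.keys (frag_of x). f y [^] Poly_Mapping.lookup (frag_of x) y) = f x"
  by simp

text \<open>These are the maps that factor through the tensor product as an abelian group. The
  target carries no scalar action here, so the induced maps are additive, and compatibility with
  scalars is proved separately.\<close>

definition balanced_maps ::
  "('r, 's) ring_scheme \<Rightarrow> ('r, 'a, 'm) module_scheme \<Rightarrow> ('r, 'b, 'n) module_scheme
    \<Rightarrow> ('c, 'q) ring_scheme \<Rightarrow> ('a \<Rightarrow> 'b \<Rightarrow> 'c) set"
  where "balanced_maps R M N A =
    {f. (\<forall>a\<in>carrier M. \<forall>b\<in>carrier N. f a b \<in> carrier A) \<and>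
        (\<forall>a\<in>carrier M. \<forall>a'\<in>carrier M. \<forall>b\<in>carrier N. f (a \<oplus>\<^bsub>M\<^esub> a') b = f a b \<oplus>\<^bsub>A\<^esub> f a' b) \<and>
        (\<forall>a\<in>carrier M. \<forall>b\<in>carrier N. \<forall>b'\<in>carrier N. f a (b \<oplus>\<^bsub>N\<^esub> b') = f a b \<oplus>\<^bsub>A\<^esub> f a b') \<and>
        (\<forall>r\<in>carrier R. \<forall>a\<in>carrier M. \<forall>b\<in>carrier N. f (r \<odot>\<^bsub>M\<^esub> a) b = f a (r \<odot>\<^bsub>N\<^esub> b))}"

locale module_pair = M: module R M + N: module R N
  for R :: "('r, 's) ring_scheme" (structure)
    and M :: "('r, 'a, 'm) module_scheme" and N :: "('r, 'b, 'n) module_scheme"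
begin

abbreviation "E \<equiv> free_Abelian_group (carrier M \<times> carrier N)"
abbreviation "T \<equiv> tensor_product R M N"

lemma tensor_relations_closed: "tensor_relations R M N \<subseteq> carrier E"
  unfolding tensor_relations_def
  by (auto dest!: subsetD[OF keys_diff])

lemma tensor_relations_cases [consumes 1, case_names left right scalar]:
  assumes "u \<in> tensor_relations R M N"
  obtains a a' b where "u = frag_of (a \<oplus>\<^bsub>M\<^esub> a', b) - frag_of (a, b) - frag_of (a', b)"
      "a \<in> carrier M" "a' \<in> carrier M" "b \<in> carrier N"
    | a b b' where "u = frag_of (a, b \<oplus>\<^bsub>N\<^esub> b') - frag_of (a, b) - frag_of (a, b')"
      "a \<in> carrier M" "b \<in> carrier N" "b' \<in> carrier N"
    | r a b where "u = frag_of (r \<odot>\<^bsub>M\<^esub> a, b) - frag_of (a, r \<odot>\<^bsub>N\<^esub> b)"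
      "r \<in> carrier R" "a \<in> carrier M" "b \<in> carrier N"
  using assms unfolding tensor_relations_def
  apply (elim UnE CollectE exE conjE)
    apply (rule that(1); assumption)
   apply (rule that(2); assumption)
  apply (rule that(3); assumption)
  done

lemma tensor_null_subgroup: "subgroup (tensor_null R M N) E"
  unfolding tensor_null_def
  by (rule group.generate_is_subgroup[OF group_free_Abelian_group tensor_relations_closed])

lemma tensor_null_normal: "tensor_null R M N \<lhd> E"
  by (rule comm_group.subgroup_imp_normal[OF abelian_free_Abelian_group tensor_null_subgroup])

lemma tensor_product_abelian_group: "abelian_group T"
proof -
  interpret Q: comm_group "tensor_group R M N"
    unfolding tensor_group_def
    by (rule comm_group.abelian_FactGroup[OF abelian_free_Abelian_group tensor_null_subgroup])
  show ?thesis
    by (rule abelian_groupI)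
      (simp_all add: tensor_product_def Q.m_assoc Q.l_inv_ex, simp add: Q.m_comm)
qed

abbreviation "cls \<equiv> \<lambda>u. tensor_null R M N #>\<^bsub>E\<^esub> u"

lemma cls_hom: "cls \<in> hom E (add_monoid T)"
  using normal.r_coset_hom_Mod[OF tensor_null_normal]
  by (simp add: hom_def tensor_product_def tensor_group_def)

lemma cls_add: "Poly_Mapping.keys u \<subseteq> carrier M \<times> carrier N \<Longrightarrow>
    Poly_Mapping.keys v \<subseteq> carrier M \<times> carrier N \<Longrightarrow> cls (u + v) = cls u \<oplus>\<^bsub>T\<^esub> cls v"
  using hom_mult[OF cls_hom, of u v] by simp

lemma carrier_T: "carrier T = cls ` carrier E"
  by (simp add: tensor_product_def tensor_group_def carrier_FactGroup)

lemma cls_cong: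
  assumes "Poly_Mapping.keys u \<subseteq> carrier M \<times> carrier N" "v \<in> carrier E"
    and "u - v \<in> tensor_null R M N"
  shows "cls u = cls v"
proof -
  have "u \<in> cls v"
    using assms(3) by (auto simp: r_coset_def intro!: bexI[of _ "u - v"])
  then show ?thesis
    using group.repr_independence[OF group_free_Abelian_group _ assms(2) tensor_null_subgroup] by simp
qed

text \<open>Each identity is one of the defining relations: the difference of the formal sums on its
  two sides is a generator of \<open>tensor_null\<close>, so their cosets coincide.\<close>

lemma pure_tensor_balanced: "pure_tensor R M N \<in> balanced_maps R M N T"
proof -
  have rel: "u \<in> tensor_null R M N" if "u \<in> tensor_relations R M N" for u
    unfolding tensor_null_def by (rule generate.incl[OF that])
  have "cls (frag_of (a \<oplus>\<^bsub>M\<^esub> a', b)) = cls (frag_of (a, b)) \<oplus>\<^bsub>T\<^esub> cls (frag_of (a', b))"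
    if "a \<in> carrier M" "a' \<in> carrier M" "b \<in> carrier N" for a a' b
  proof -
    have "cls (frag_of (a \<oplus>\<^bsub>M\<^esub> a', b)) = cls (frag_of (a, b) + frag_of (a', b))"
      using that by (intro cls_cong rel)
        (auto simp: tensor_relations_def diff_diff_eq dest!: subsetD[OF keys_add])
    with that show ?thesis by (simp add: cls_add)
  qed
  moreover have "cls (frag_of (a, b \<oplus>\<^bsub>N\<^esub> b')) = cls (frag_of (a, b)) \<oplus>\<^bsub>T\<^esub> cls (frag_of (a, b'))"
    if "a \<in> carrier M" "b \<in> carrier N" "b' \<in> carrier N" for a b b'
  proof -
    have "cls (frag_of (a, b \<oplus>\<^bsub>N\<^esub> b')) = cls (frag_of (a, b) + frag_of (a, b'))"
      using that by (intro cls_cong rel)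
        (auto simp: tensor_relations_def diff_diff_eq dest!: subsetD[OF keys_add])
    with that show ?thesis by (simp add: cls_add)
  qed
  moreover have "cls (frag_of (r \<odot>\<^bsub>M\<^esub> a, b)) = cls (frag_of (a, r \<odot>\<^bsub>N\<^esub> b))"
    if "r \<in> carrier R" "a \<in> carrier M" "b \<in> carrier N" for r a b
    using that by (intro cls_cong rel) (auto simp: tensor_relations_def)
  ultimately show ?thesis
    by (auto simp: balanced_maps_def pure_tensor_def carrier_T)
qed

lemma pure_tensor_closed [simp]:
  "a \<in> carrier M \<Longrightarrow> b \<in> carrier N \<Longrightarrow> pure_tensor R M N a b \<in> carrier T"
  using pure_tensor_balanced by (auto simp: balanced_maps_def)

text \<open>The uniqueness half of the universal property. Formal sums arise from basis elements by
  differences, hence pure tensors generate the group. Later identities between maps on tensors are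
  checked on pure tensors by this rule.\<close>

lemma tensor_hom_ext:
  assumes f: "abelian_group_hom T A f" and g: "abelian_group_hom T A g"
    and eq: "\<And>a b. a \<in> carrier M \<Longrightarrow> b \<in> carrier N
      \<Longrightarrow> f (pure_tensor R M N a b) = g (pure_tensor R M N a b)"
    and z: "z \<in> carrier T"
  shows "f z = g z"
proof -
  interpret f: abelian_group_hom T A f by fact
  interpret g: abelian_group_hom T A g by fact
  interpret c: group_hom E "add_monoid T" cls
    by (intro group_hom.intro group_hom_axioms.intro group_free_Abelian_group f.G.a_group cls_hom)
  obtain u where u: "Poly_Mapping.keys u \<subseteq> carrier M \<times> carrier N" and zu: "z = cls u"
    using z by (auto simp: carrier_T)
  have "f (cls u) = g (cls u)"
    using u
  proof (rule free_Abelian_group_induct)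
    show "f (cls 0) = g (cls 0)"
      using c.hom_one by simp
  next
    fix u v
    assume uv: "Poly_Mapping.keys u \<subseteq> carrier M \<times> carrier N"
      "Poly_Mapping.keys v \<subseteq> carrier M \<times> carrier N" "f (cls u) = g (cls u)" "f (cls v) = g (cls v)"
    have "cls (u - v) = cls u \<oplus>\<^bsub>T\<^esub> \<ominus>\<^bsub>T\<^esub> cls v"
      using uv c.hom_inv[of v] cls_add[of u "- v"] by (simp add: a_inv_def)
    moreover have "cls u \<in> carrier T" "cls v \<in> carrier T"
      using uv by (auto simp: carrier_T)
    ultimately show "f (cls (u - v)) = g (cls (u - v))"
      using uv by simp
  next
    fix p assume "p \<in> carrier M \<times> carrier N"
    then show "f (cls (frag_of p)) = g (cls (frag_of p))"
      using eq[of "fst p" "snd p"] by (auto simp: pure_tensor_def)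
  qed
  with zu show ?thesis by simp
qed

context
  fixes A :: "('c, 'q) ring_scheme" and f
  assumes A: "abelian_group A" and f: "f \<in> balanced_maps R M N A"
begin

interpretation A: abelian_group A by (rule A)

text \<open>The evaluation of formal sums inside \<open>tensor_lift\<close>, with projections in
  place of a pattern so that the result on free abelian groups applies. Products and powers in
  \<open>add_monoid A\<close> are sums and integer multiples in \<open>A\<close>.\<close>

abbreviation "ev \<equiv> \<lambda>u :: 'a \<times> 'b \<Rightarrow>\<^sub>0 int. finprod (add_monoid A)
  (\<lambda>p. f (fst p) (snd p) [^]\<^bsub>add_monoid A\<^esub> Poly_Mapping.lookup u p) (Poly_Mapping.keys u)"

lemma ev_hom: "group_hom E (add_monoid A) ev"
proof -
  have "(\<lambda>p. f (fst p) (snd p)) \<in> carrier M \<times> carrier N \<rightarrow> carrier (add_monoid A)"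
    using f by (auto simp: balanced_maps_def)
  from comm_group.finprod_pow_lookup_hom[OF A.a_comm_group this] show ?thesis
    by (auto intro!: group_hom.intro group_hom_axioms.intro A.a_group)
qed

interpretation ev: group_hom E "add_monoid A" ev by (rule ev_hom)

lemma ev_frag_of:
  assumes "a \<in> carrier M" "b \<in> carrier N"
  shows "ev (frag_of (a, b)) = f a b"
proof -
  have "f a b \<in> carrier (add_monoid A)"
    using assms f by (auto simp: balanced_maps_def)
  then show ?thesis
    using comm_group.finprod_pow_lookup_frag_of[OF A.a_comm_group, of "\<lambda>p. f (fst p) (snd p)" "(a, b)"]
    by (simp del: keys_frag_of lookup_frag_of)
qed

lemma ev_diff:
  assumes "Poly_Mapping.keys u \<subseteq> carrier M \<times> carrier N" "Poly_Mapping.keys v \<subseteq> carrier M \<times> carrier N"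
  shows "ev (u - v) = ev u \<oplus>\<^bsub>A\<^esub> \<ominus>\<^bsub>A\<^esub> ev v"
  using assms ev.hom_mult[of u "- v"] ev.hom_inv[of v] by (simp add: a_inv_def)

text \<open>The kernel of \<open>ev\<close> is a subgroup, so only the generators of
  \<open>tensor_null\<close> have to be checked, and the three kinds of relations are killed by the
  three laws of a balanced map.\<close>

lemma tensor_null_kernel: "tensor_null R M N \<subseteq> kernel E (add_monoid A) ev"
  unfolding tensor_null_def
proof (rule group.generate_subgroup_incl[OF group_free_Abelian_group _ ev.subgroup_kernel])
  have fc: "\<And>a b. a \<in> carrier M \<Longrightarrow> b \<in> carrier N \<Longrightarrow> f a b \<in> carrier A"
    using f by (simp add: balanced_maps_def)
  \<comment> \<open>Both biadditivity relations have the shape \<open>p - q - s\<close>, so one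
    computation serves for the two of them.\<close>
  have ev0: "ev (frag_of p - frag_of q - frag_of s) = \<zero>\<^bsub>A\<^esub>"
    if "p \<in> carrier M \<times> carrier N" "q \<in> carrier M \<times> carrier N" "s \<in> carrier M \<times> carrier N"
      "f (fst p) (snd p) = f (fst q) (snd q) \<oplus>\<^bsub>A\<^esub> f (fst s) (snd s)" for p q s
  proof -
    have "Poly_Mapping.keys (frag_of p - frag_of q) \<subseteq> carrier M \<times> carrier N"
      using that keys_diff[of "frag_of p" "frag_of q"] by auto
    then have "ev (frag_of p - frag_of q - frag_of s)
        = f (fst p) (snd p) \<oplus>\<^bsub>A\<^esub> \<ominus>\<^bsub>A\<^esub> f (fst q) (snd q) \<oplus>\<^bsub>A\<^esub> \<ominus>\<^bsub>A\<^esub> f (fst s) (snd s)"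
      using that ev_frag_of[of "fst p" "snd p"] ev_frag_of[of "fst q" "snd q"]
        ev_frag_of[of "fst s" "snd s"]
      by (subst ev_diff | simp add: mem_Times_iff)+
    also have "\<dots> = \<zero>\<^bsub>A\<^esub>"
      using that fc[of "fst q" "snd q"] fc[of "fst s" "snd s"]
      by (simp only: A.add_diff_cancel mem_Times_iff)
    finally show ?thesis .
  qed
  show "tensor_relations R M N \<subseteq> kernel E (add_monoid A) ev"
  proof
    fix u assume u: "u \<in> tensor_relations R M N"
    then have "u \<in> carrier E"
      using tensor_relations_closed by blast
    moreover from u have "ev u = \<zero>\<^bsub>A\<^esub>"
    proof (cases rule: tensor_relations_cases)
      case (left a a' b)
      then have "f (a \<oplus>\<^bsub>M\<^esub> a') b = f a b \<oplus>\<^bsub>A\<^esub> f a' b"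
        using f by (simp add: balanced_maps_def)
      then show ?thesis
        unfolding left(1) using left(2-4) by (intro ev0) simp_all
    next
      case (right a b b')
      then have "f a (b \<oplus>\<^bsub>N\<^esub> b') = f a b \<oplus>\<^bsub>A\<^esub> f a b'"
        using f by (simp add: balanced_maps_def)
      then show ?thesis
        unfolding right(1) using right(2-4) by (intro ev0) simp_all
    next
      case (scalar r a b)
      have "ev u = ev (frag_of (r \<odot>\<^bsub>M\<^esub> a, b)) \<oplus>\<^bsub>A\<^esub> \<ominus>\<^bsub>A\<^esub> ev (frag_of (a, r \<odot>\<^bsub>N\<^esub> b))"
        unfolding scalar(1) using scalar(2-4) by (intro ev_diff) simp_all
      also have "\<dots> = f (r \<odot>\<^bsub>M\<^esub> a) b \<oplus>\<^bsub>A\<^esub> \<ominus>\<^bsub>A\<^esub> f a (r \<odot>\<^bsub>N\<^esub> b)"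
        using scalar(2-4) by (simp only: ev_frag_of M.smult_closed N.smult_closed)
      also have "f (r \<odot>\<^bsub>M\<^esub> a) b = f a (r \<odot>\<^bsub>N\<^esub> b)"
        using f scalar(2-4) by (simp add: balanced_maps_def)
      finally show ?thesis
        using fc scalar(2-4) by (simp add: A.r_neg)
    qed
    ultimately show "u \<in> kernel E (add_monoid A) ev"
      by (simp add: kernel_def)
  qed
qed

text \<open>This justifies \<open>the_elem\<close> in \<open>tensor_lift\<close>: representatives of
  a coset differ by elements of \<open>tensor_null\<close>, on which \<open>ev\<close> vanishes, so
  the set of values is a singleton.\<close>

lemma tensor_lift_cls:
  assumes u: "u \<in> carrier E"
  shows "tensor_lift (add_monoid A) f (cls u) = ev u"
proof -
  have const: "ev v = ev u" if "v \<in> cls u" for v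
  proof -
    obtain n where n: "n \<in> tensor_null R M N" "v = n + u"
      using \<open>v \<in> cls u\<close> by (auto simp: r_coset_def)
    then have "n \<in> carrier E" "ev n = \<zero>\<^bsub>A\<^esub>"
      using tensor_null_kernel by (auto simp: kernel_def)
    then show ?thesis
      using ev.hom_mult[of n u] u n ev.hom_closed[OF u] by simp
  qed
  have "u \<in> cls u"
    by (rule group.rcos_self[OF group_free_Abelian_group u tensor_null_subgroup])
  then have "cls u \<noteq> {}"
    by blast
  then have "the_elem (ev ` cls u) = ev u"
    by (rule the_elem_image_unique[where f = ev, OF _ const])
  then show ?thesis
    unfolding tensor_lift_def by (simp add: case_prod_beta')
qed

lemma tensor_lift_hom: "abelian_group_hom T A (tensor_lift (add_monoid A) f)"
proof (rule abelian_group_homI[OF tensor_product_abelian_group A])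
  fix x assume "x \<in> carrier T"
  then show "tensor_lift (add_monoid A) f x \<in> carrier A"
    using ev.hom_closed by (auto simp: carrier_T tensor_lift_cls)
next
  fix x y assume "x \<in> carrier T" "y \<in> carrier T"
  then obtain u v where uv: "u \<in> carrier E" "x = cls u" "v \<in> carrier E" "y = cls v"
    by (auto simp: carrier_T)
  then have "u + v \<in> carrier E"
    using keys_add[of u v] by auto
  with uv have "x \<oplus>\<^bsub>T\<^esub> y = cls (u + v)" "ev (u + v) = ev u \<oplus>\<^bsub>A\<^esub> ev v"
    using cls_add[of u v] ev.hom_mult[of u v] by simp_all
  with uv \<open>u + v \<in> carrier E\<close>
  show "tensor_lift (add_monoid A) f (x \<oplus>\<^bsub>T\<^esub> y)
      = tensor_lift (add_monoid A) f x \<oplus>\<^bsub>A\<^esub> tensor_lift (add_monoid A) f y"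
    by (simp only: tensor_lift_cls)
qed

lemma tensor_lift_pure:
  "a \<in> carrier M \<Longrightarrow> b \<in> carrier N \<Longrightarrow> tensor_lift (add_monoid A) f (pure_tensor R M N a b) = f a b"
  using tensor_lift_cls[of "frag_of (a, b)"] ev_frag_of[of a b]
  by (simp add: pure_tensor_def del: keys_frag_of lookup_frag_of)

end

end

section \<open>Tensor products of linear maps and images of submodules\<close>

lemma linear_map_abelian_group_hom:
  assumes "module R M" "module R N" "f \<in> linear_maps R M N"
  shows "abelian_group_hom M N f"
  using assms by (intro abelian_group_homI) (auto simp: linear_maps_def dest: module.axioms(2))

lemma pure_tensor_linear_balanced:
  assumes "module_pair R M N" "module_pair R M' N'"
    and f: "f \<in> linear_maps R M M'" and g: "g \<in> linear_maps R N N'"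
  shows "(\<lambda>a b. pure_tensor R M' N' (f a) (g b)) \<in> balanced_maps R M N (tensor_product R M' N')"
proof -
  interpret T': module_pair R M' N' by fact
  show ?thesis
    using f g T'.pure_tensor_balanced by (auto simp: balanced_maps_def linear_maps_def Pi_iff)
qed

lemma tensor_map_hom:
  assumes MN: "module_pair R M N" and MN': "module_pair R M' N'"
    and f: "f \<in> linear_maps R M M'" and g: "g \<in> linear_maps R N N'"
  shows "abelian_group_hom (tensor_product R M N) (tensor_product R M' N') (tensor_map R M' N' f g)"
  unfolding tensor_map_def
  by (rule module_pair.tensor_lift_hom[OF MN module_pair.tensor_product_abelian_group[OF MN']
      pure_tensor_linear_balanced[OF assms]])

lemma tensor_map_pure:
  assumes MN: "module_pair R M N" and MN': "module_pair R M' N'"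
    and f: "f \<in> linear_maps R M M'" and g: "g \<in> linear_maps R N N'"
    and "a \<in> carrier M" "b \<in> carrier N"
  shows "tensor_map R M' N' f g (pure_tensor R M N a b) = pure_tensor R M' N' (f a) (g b)"
  unfolding tensor_map_def
  by (rule module_pair.tensor_lift_pure[OF MN module_pair.tensor_product_abelian_group[OF MN']
      pure_tensor_linear_balanced[OF MN MN' f g]]) fact+

text \<open>The two sides lift into different presentations of the same group,
  \<open>tensor_group\<close> and the additive monoid of \<open>tensor_product\<close>. Sums and
  multiples depend only on carrier, operation and neutral element, which agree. The scalar action
  thereby falls under the rules for \<open>tensor_map\<close>.\<close>

lemma smult_tensor_product:
  "r \<odot>\<^bsub>tensor_product R M N\<^esub> z = tensor_map R M N (\<lambda>a. r \<odot>\<^bsub>M\<^esub> a) (\<lambda>b. b) z"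
  by (simp add: tensor_map_def tensor_lift_def tensor_product_def finprod_def int_pow_def nat_pow_def
      m_inv_def Let_def cong: if_cong)

context module_pair
begin

lemma smult_linear: "r \<in> carrier R \<Longrightarrow> (\<lambda>a. r \<odot>\<^bsub>M\<^esub> a) \<in> linear_maps R M M"
  by (auto simp: linear_maps_def M.smult_r_distr M.R.m_comm simp flip: M.smult_assoc1)

lemma id_linear: "(\<lambda>b. b) \<in> linear_maps R N N"
  by (auto simp: linear_maps_def)

context
  fixes A B
  assumes A: "submodule A R M" and B: "submodule B R N"
begin

lemma submodule_pair: "module_pair R (M\<lparr>carrier := A\<rparr>) (N\<lparr>carrier := B\<rparr>)"
  by (intro module_pair.intro submodule.submodule_is_module A B M.module_axioms N.module_axioms)

lemma submodule_inclusion: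
  "(\<lambda>a. a) \<in> linear_maps R (M\<lparr>carrier := A\<rparr>) M" "(\<lambda>b. b) \<in> linear_maps R (N\<lparr>carrier := B\<rparr>) N"
  using M.submoduleE(1)[OF A] N.submoduleE(1)[OF B] by (auto simp: linear_maps_def)

lemmas inclusion_hom = tensor_map_hom[OF submodule_pair module_pair_axioms submodule_inclusion]

lemma tensor_image_subset: "tensor_image R M N A B \<subseteq> carrier T"
  using abelian_group_hom.hom_closed[OF inclusion_hom] by (auto simp: tensor_image_def)

text \<open>Pulling \<open>f\<close> and \<open>g\<close> back along the map induced by the two
  inclusions turns the claim into a comparison on the tensor product of the submodules, where pure
  tensors suffice.\<close>

lemma tensor_image_hom_ext:
  assumes f: "abelian_group_hom T C f" and g: "abelian_group_hom T C g"
    and eq: "\<And>a b. a \<in> A \<Longrightarrow> b \<in> B \<Longrightarrow> f (pure_tensor R M N a b) = g (pure_tensor R M N a b)"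
    and z: "z \<in> tensor_image R M N A B"
  shows "f z = g z"
proof -
  let ?i = "tensor_map R M N (\<lambda>a. a) (\<lambda>b. b)"
  obtain w where w: "w \<in> carrier (tensor_product R (M\<lparr>carrier := A\<rparr>) (N\<lparr>carrier := B\<rparr>))" "z = ?i w"
    using z by (auto simp: tensor_image_def)
  have "f (?i w) = g (?i w)"
    by (rule module_pair.tensor_hom_ext[OF submodule_pair abelian_group_hom_compose[OF inclusion_hom f]
          abelian_group_hom_compose[OF inclusion_hom g] _ w(1)])
      (simp add: tensor_map_pure[OF submodule_pair module_pair_axioms submodule_inclusion] eq)
  with w show ?thesis by simp
qed

end

end

section \<open>Convolution with the identity\<close>

context algebra
begin

sublocale HH: module_pair R M M
  by (intro module_pair.intro module)

lemma smult_assoc2_right: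
  "r \<in> carrier R \<Longrightarrow> x \<in> carrier M \<Longrightarrow> y \<in> carrier M \<Longrightarrow> x \<otimes>\<^bsub>M\<^esub> (r \<odot>\<^bsub>M\<^esub> y) = r \<odot>\<^bsub>M\<^esub> (x \<otimes>\<^bsub>M\<^esub> y)"
  by (simp add: m_comm[of x] smult_assoc2)

end

context left_counital_operated_bialgebra
begin

abbreviation "HH \<equiv> tensor_product R H H"

lemma H_abelian_group: "abelian_group H"
  by (rule module.axioms(2)[OF module])

lemma linear_hom: "f \<in> linear_maps R H H \<Longrightarrow> abelian_group_hom H H f"
  by (rule linear_map_abelian_group_hom[OF module module])

lemma linear_closed: "f \<in> linear_maps R H H \<Longrightarrow> x \<in> carrier H \<Longrightarrow> f x \<in> carrier H"
  by (auto simp: linear_maps_def)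

lemma linear_smult: "f \<in> linear_maps R H H \<Longrightarrow> r \<in> carrier R \<Longrightarrow> x \<in> carrier H \<Longrightarrow>
    f (r \<odot>\<^bsub>H\<^esub> x) = r \<odot>\<^bsub>H\<^esub> f x"
  by (auto simp: linear_maps_def)

lemma one_H_closed: "\<one>\<^bsub>H\<^esub> \<in> carrier H"
  by (rule monoid.one_closed[OF ring.is_monoid[OF cring.axioms(1)[OF M_cring]]])

lemma coproduct_closed: "x \<in> carrier H \<Longrightarrow> \<Delta> x \<in> carrier HH"
  using coproduct_linear by (auto simp: linear_maps_def)

lemma coproduct_add: "x \<in> carrier H \<Longrightarrow> y \<in> carrier H \<Longrightarrow> \<Delta> (x \<oplus>\<^bsub>H\<^esub> y) = \<Delta> x \<oplus>\<^bsub>HH\<^esub> \<Delta> y"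
  using coproduct_linear by (auto simp: linear_maps_def)

lemma coproduct_smult: "r \<in> carrier R \<Longrightarrow> x \<in> carrier H \<Longrightarrow> \<Delta> (r \<odot>\<^bsub>H\<^esub> x) = r \<odot>\<^bsub>HH\<^esub> \<Delta> x"
  using coproduct_linear by (auto simp: linear_maps_def)

lemma coproduct_one: "\<Delta> \<one>\<^bsub>H\<^esub> = pure_tensor R H H \<one>\<^bsub>H\<^esub> \<one>\<^bsub>H\<^esub>"
  using ring_hom_one[OF coproduct_hom] by (simp add: tensor_product_def)

lemma counit_closed: "x \<in> carrier H \<Longrightarrow> \<epsilon> x \<in> carrier R"
  using counit_linear by (auto simp: linear_maps_def regular_module_def)

lemma counit_add: "x \<in> carrier H \<Longrightarrow> y \<in> carrier H \<Longrightarrow> \<epsilon> (x \<oplus>\<^bsub>H\<^esub> y) = \<epsilon> x \<oplus>\<^bsub>R\<^esub> \<epsilon> y"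
  using counit_linear by (auto simp: linear_maps_def regular_module_def)

lemma counit_smult: "r \<in> carrier R \<Longrightarrow> x \<in> carrier H \<Longrightarrow> \<epsilon> (r \<odot>\<^bsub>H\<^esub> x) = r \<otimes>\<^bsub>R\<^esub> \<epsilon> x"
  using counit_linear by (auto simp: linear_maps_def regular_module_def)

lemma counit_one: "\<epsilon> \<one>\<^bsub>H\<^esub> = \<one>\<^bsub>R\<^esub>"
  by (rule ring_hom_one[OF counit_hom])

text \<open>This is \<open>m (id \<otimes> f)\<close>, written as a single lift so that it is
  literally the expression occurring in \<open>antipode_recursion\<close>; on
  \<open>\<Delta> x\<close> it gives the convolution of the identity with \<open>f\<close>.\<close>

definition mult_lift :: "('a \<Rightarrow> 'a) \<Rightarrow> ('a \<times> 'a \<Rightarrow>\<^sub>0 int) set \<Rightarrow> 'a"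
  where "mult_lift f = tensor_lift (add_monoid H) (\<lambda>a b. a \<otimes>\<^bsub>H\<^esub> f b)"

lemma mult_balanced:
  assumes "f \<in> linear_maps R H H"
  shows "(\<lambda>a b. a \<otimes>\<^bsub>H\<^esub> f b) \<in> balanced_maps R H H H"
proof -
  show ?thesis
    using assms by (auto simp: balanced_maps_def linear_maps_def Pi_iff l_distr r_distr
        smult_assoc2 smult_assoc2_right)
qed

lemma mult_lift_hom: "f \<in> linear_maps R H H \<Longrightarrow> abelian_group_hom HH H (mult_lift f)"
  unfolding mult_lift_def by (rule HH.tensor_lift_hom[OF H_abelian_group mult_balanced])

lemma mult_lift_pure:
  "f \<in> linear_maps R H H \<Longrightarrow> a \<in> carrier H \<Longrightarrow> b \<in> carrier H \<Longrightarrow>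
    mult_lift f (pure_tensor R H H a b) = a \<otimes>\<^bsub>H\<^esub> f b"
  unfolding mult_lift_def by (rule HH.tensor_lift_pure[OF H_abelian_group mult_balanced])

text \<open>The lift is additive by construction; homogeneity follows because both sides are
  additive in \<open>z\<close> and agree on pure tensors, where the scalar acts on the left
  factor.\<close>

lemma mult_lift_smult:
  assumes f: "f \<in> linear_maps R H H" and r: "r \<in> carrier R" and z: "z \<in> carrier HH"
  shows "mult_lift f (r \<odot>\<^bsub>HH\<^esub> z) = r \<odot>\<^bsub>H\<^esub> mult_lift f z"
  unfolding smult_tensor_product
proof (rule HH.tensor_hom_ext[OF _ _ _ z])
  note lin = HH.smult_linear[OF r] HH.id_linear
  show "abelian_group_hom HH H (\<lambda>z. mult_lift f (tensor_map R H H (\<lambda>a. r \<odot>\<^bsub>H\<^esub> a) (\<lambda>b. b) z))"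
    by (rule abelian_group_hom_compose[OF tensor_map_hom mult_lift_hom[OF f]])
      (rule HH.module_pair_axioms lin)+
  show "abelian_group_hom HH H (\<lambda>z. r \<odot>\<^bsub>H\<^esub> mult_lift f z)"
    by (rule abelian_group_hom_compose[OF mult_lift_hom[OF f] linear_hom[OF HH.smult_linear[OF r]]])
  show "mult_lift f (tensor_map R H H (\<lambda>a. r \<odot>\<^bsub>H\<^esub> a) (\<lambda>b. b) (pure_tensor R H H a b))
      = r \<odot>\<^bsub>H\<^esub> mult_lift f (pure_tensor R H H a b)"
    if "a \<in> carrier H" "b \<in> carrier H" for a b
    using that f r linear_closed[OF f]
    by (subst tensor_map_pure[OF HH.module_pair_axioms HH.module_pair_axioms lin])
      (simp_all add: mult_lift_pure smult_assoc2)
qed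

lemma convolution_id_eq:
  assumes f: "f \<in> linear_maps R H H" and x: "x \<in> carrier H"
  shows "convolution R H \<Delta> (\<lambda>y. y) f x = mult_lift f (\<Delta> x)"
  unfolding convolution_def
proof (rule HH.tensor_hom_ext[OF _ mult_lift_hom[OF f] _ coproduct_closed[OF x]])
  have mult: "mult_map H = mult_lift (\<lambda>y. y)"
    by (simp add: mult_map_def mult_lift_def)
  show "abelian_group_hom HH H (\<lambda>z. mult_map H (tensor_map R H H (\<lambda>y. y) f z))"
    unfolding mult
    by (rule abelian_group_hom_compose[OF tensor_map_hom mult_lift_hom])
      (rule HH.module_pair_axioms HH.id_linear f)+
  show "mult_map H (tensor_map R H H (\<lambda>y. y) f (pure_tensor R H H a b))
      = mult_lift f (pure_tensor R H H a b)" if "a \<in> carrier H" "b \<in> carrier H" for a b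
    using that f linear_closed[OF f] unfolding mult
    by (subst tensor_map_pure[OF HH.module_pair_axioms HH.module_pair_axioms HH.id_linear f])
      (simp_all add: mult_lift_pure HH.id_linear)
qed

lemma convolution_id_linear:
  assumes f: "f \<in> linear_maps R H H"
  shows "(\<lambda>x. mult_lift f (\<Delta> x)) \<in> linear_maps R H H"
proof -
  interpret h: abelian_group_hom HH H "mult_lift f" by (rule mult_lift_hom[OF f])
  show ?thesis
    by (auto simp: linear_maps_def coproduct_closed coproduct_add coproduct_smult mult_lift_smult[OF f])
qed

text \<open>The subtracted tensor \<open>1 \<otimes> x\<close> contributes exactly
  \<open>1 \<cdot> f x\<close>.\<close>

lemma mult_lift_reduced_coproduct:
  assumes f: "f \<in> linear_maps R H H" and x: "x \<in> carrier H"
  shows "mult_lift f (reduced_coproduct R H \<Delta> x) = mult_lift f (\<Delta> x) \<ominus>\<^bsub>H\<^esub> f x"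
proof -
  interpret h: abelian_group_hom HH H "mult_lift f" by (rule mult_lift_hom[OF f])
  show ?thesis
    unfolding reduced_coproduct_def a_minus_def
    using f x linear_closed[OF f] by (simp add: coproduct_closed mult_lift_pure)
qed

lemma right_antipode_iff:
  assumes S: "S \<in> linear_maps R H H"
  shows "right_antipode R H \<Delta> \<epsilon> S \<longleftrightarrow>
    (\<forall>x\<in>carrier H. mult_lift S (\<Delta> x) = \<epsilon> x \<odot>\<^bsub>H\<^esub> \<one>\<^bsub>H\<^esub>)"
  using S by (simp add: right_antipode_def convolution_id_eq unit_map_def)

text \<open>On the kernel of \<epsilon> the term \<open>S x\<close> cancels from the recursion,
  which then says that \<open>id * S\<close> vanishes there; at 1 it says that \<open>id * S\<close>
  is 1, as \<open>\<Delta> 1 = 1 \<otimes> 1\<close>. Since \<open>H\<close> is the sum of the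
  kernel and the multiples of 1, linearity extends the equation to all of \<open>H\<close>.\<close>

lemma antipode_recursion_iff:
  assumes S: "S \<in> linear_maps R H H"
  shows "antipode_recursion R H \<Delta> \<epsilon> S \<longleftrightarrow> right_antipode R H \<Delta> \<epsilon> S"
proof -
  let ?c = "\<lambda>x. mult_lift S (\<Delta> x)"
  have c: "?c \<in> linear_maps R H H"
    by (rule convolution_id_linear[OF S])
  note S_closed = linear_closed[OF S] and c_closed = linear_closed[OF c]
  have ker: "x \<in> a_kernel H R \<epsilon> \<longleftrightarrow> x \<in> carrier H \<and> \<epsilon> x = \<zero>\<^bsub>R\<^esub>" for x
    by (auto simp: a_kernel_def kernel_def)
  have step: "S x = \<ominus>\<^bsub>H\<^esub> mult_lift S (reduced_coproduct R H \<Delta> x) \<longleftrightarrow> ?c x = \<zero>\<^bsub>H\<^esub>"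
    if x: "x \<in> carrier H" for x
  proof -
    have "\<ominus>\<^bsub>H\<^esub> mult_lift S (reduced_coproduct R H \<Delta> x) = S x \<ominus>\<^bsub>H\<^esub> ?c x"
      using S_closed[OF x] c_closed[OF x]
      by (simp add: mult_lift_reduced_coproduct[OF S x] a_minus_def M.minus_add M.a_comm)
    moreover have "S x = S x \<ominus>\<^bsub>H\<^esub> ?c x \<longleftrightarrow> ?c x = \<zero>\<^bsub>H\<^esub>"
      using S_closed[OF x] c_closed[OF x]
      by (simp add: M.minus_eq M.add.r_cancel_one' M.add.inv_eq_1_iff)
    ultimately show ?thesis by simp
  qed
  have c_one: "?c \<one>\<^bsub>H\<^esub> = S \<one>\<^bsub>H\<^esub>"
    using S_closed by (simp add: coproduct_one mult_lift_pure[OF S])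
  have rec: "antipode_recursion R H \<Delta> \<epsilon> S \<longleftrightarrow>
      ?c \<one>\<^bsub>H\<^esub> = \<one>\<^bsub>H\<^esub> \<and> (\<forall>x\<in>carrier H. \<epsilon> x = \<zero>\<^bsub>R\<^esub> \<longrightarrow> ?c x = \<zero>\<^bsub>H\<^esub>)"
    unfolding antipode_recursion_def mult_lift_def[symmetric] c_one
    using step by (auto simp: ker)
  show ?thesis
    unfolding rec right_antipode_iff[OF S]
  proof safe
    fix x assume one: "?c \<one>\<^bsub>H\<^esub> = \<one>\<^bsub>H\<^esub>" and
      ker0: "\<forall>x\<in>carrier H. \<epsilon> x = \<zero>\<^bsub>R\<^esub> \<longrightarrow> ?c x = \<zero>\<^bsub>H\<^esub>" and x: "x \<in> carrier H"
    \<comment> \<open>The splitting of \<open>x\<close> induced by \<epsilon>: \<open>?y\<close> is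
      its part in the kernel and \<open>?e\<close> its part along the unit.\<close>
    let ?e = "\<epsilon> x \<odot>\<^bsub>H\<^esub> \<one>\<^bsub>H\<^esub>" and ?y = "x \<oplus>\<^bsub>H\<^esub> (\<ominus>\<^bsub>R\<^esub> \<epsilon> x) \<odot>\<^bsub>H\<^esub> \<one>\<^bsub>H\<^esub>"
    have y: "?y \<in> carrier H" "\<epsilon> ?y = \<zero>\<^bsub>R\<^esub>"
      using x counit_closed[OF x] by (simp_all add: counit_add counit_smult counit_one R.r_neg)
    have "x = ?y \<oplus>\<^bsub>H\<^esub> ?e"
      using x counit_closed[OF x] by (simp add: M.a_assoc smult_l_minus M.l_neg)
    then have "?c x = ?c ?y \<oplus>\<^bsub>H\<^esub> ?c ?e"
      using abelian_group_hom.hom_add[OF linear_hom[OF c] y(1), of ?e] counit_closed[OF x] by simp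
    also have "\<dots> = ?e"
      using ker0 y one counit_closed[OF x] linear_smult[OF c counit_closed[OF x] one_H_closed] by simp
    finally show "?c x = ?e" .
  qed (simp_all add: counit_one)
qed

text \<open>This is \<open>\<epsilon> \<otimes> id\<close> followed by the identification of
  \<open>k \<otimes> H\<close> with \<open>H\<close>.\<close>

definition counit_lift :: "('a \<times> 'a \<Rightarrow>\<^sub>0 int) set \<Rightarrow> 'a"
  where "counit_lift = tensor_lift (add_monoid H) (\<lambda>a b. \<epsilon> a \<odot>\<^bsub>H\<^esub> b)"

lemma counit_balanced: "(\<lambda>a b. \<epsilon> a \<odot>\<^bsub>H\<^esub> b) \<in> balanced_maps R H H H"
  by (auto simp: balanced_maps_def counit_closed counit_add counit_smult smult_l_distr smult_r_distr
      R.m_comm simp flip: smult_assoc1)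

lemma counit_lift_hom: "abelian_group_hom HH H counit_lift"
  unfolding counit_lift_def by (rule HH.tensor_lift_hom[OF H_abelian_group counit_balanced])

lemma counit_lift_pure: "a \<in> carrier H \<Longrightarrow> b \<in> carrier H \<Longrightarrow>
    counit_lift (pure_tensor R H H a b) = \<epsilon> a \<odot>\<^bsub>H\<^esub> b"
  unfolding counit_lift_def by (rule HH.tensor_lift_pure[OF H_abelian_group counit_balanced])

lemma regular_module_module: "module R (regular_module R)"
  by (intro moduleI abelian_groupI R.is_cring)
    (auto simp: regular_module_def R.a_ac R.l_distr R.r_distr R.m_assoc intro: R.l_neg bexI[of _ "\<ominus>\<^bsub>R\<^esub> _"])

text \<open>Left counitality is an equation in \<open>k \<otimes> H\<close>. The map
  \<open>?s\<close>, induced by the scalar action, carries it to \<open>H\<close>, and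
  \<open>counit_lift\<close> is the composite of \<open>\<epsilon> \<otimes> id\<close> with
  \<open>?s\<close>, as seen on pure tensors.\<close>

lemma counit_lift_coproduct:
  assumes x: "x \<in> carrier H"
  shows "counit_lift (\<Delta> x) = x"
proof -
  interpret K: module_pair R "regular_module R" H
    by (intro module_pair.intro regular_module_module module)
  let ?s = "tensor_lift (add_monoid H) (\<lambda>r b. r \<odot>\<^bsub>H\<^esub> b)"
  have bal: "(\<lambda>r b. r \<odot>\<^bsub>H\<^esub> b) \<in> balanced_maps R (regular_module R) H H"
    by (auto simp: balanced_maps_def regular_module_def smult_l_distr smult_r_distr R.m_comm
        simp flip: smult_assoc1)
  note s_pure = K.tensor_lift_pure[OF H_abelian_group bal]
  note map = HH.module_pair_axioms K.module_pair_axioms counit_linear HH.id_linear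
  have "counit_lift (\<Delta> x) = ?s (tensor_map R (regular_module R) H \<epsilon> (\<lambda>y. y) (\<Delta> x))"
  proof (rule HH.tensor_hom_ext[OF counit_lift_hom _ _ coproduct_closed[OF x]])
    show "abelian_group_hom HH H (\<lambda>z. ?s (tensor_map R (regular_module R) H \<epsilon> (\<lambda>y. y) z))"
      by (rule abelian_group_hom_compose[OF tensor_map_hom[OF map]
            K.tensor_lift_hom[OF H_abelian_group bal]])
    show "counit_lift (pure_tensor R H H a b)
        = ?s (tensor_map R (regular_module R) H \<epsilon> (\<lambda>y. y) (pure_tensor R H H a b))"
      if "a \<in> carrier H" "b \<in> carrier H" for a b
      using that by (simp add: tensor_map_pure[OF map] counit_lift_pure)
        (subst s_pure, simp_all add: regular_module_def counit_closed)
  qed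
  also have "\<dots> = \<one>\<^bsub>R\<^esub> \<odot>\<^bsub>H\<^esub> x"
    unfolding left_counital[OF x] using x by (intro s_pure) (auto simp: regular_module_def)
  finally show ?thesis
    using x by simp
qed

end

section \<open>Existence and uniqueness of the right antipode\<close>

context connected_filtered_left_counital_operated_bialgebra
begin

section \<open>Coproducts of elements of bounded filtration degree\<close>

lemma filtration_le: "m \<le> n \<Longrightarrow> F m \<subseteq> F n"
  by (rule lift_Suc_mono_le[of F, OF filtration_mono])

lemma filtration_closed: "x \<in> F n \<Longrightarrow> x \<in> carrier H"
  using filtration_exhaustive by blast

lemma filtration_directed:
  assumes "x \<in> carrier H" "y \<in> carrier H"
  obtains n where "x \<in> F n" "y \<in> F n"
proof -
  have "x \<in> (\<Union>n. F n)" "y \<in> (\<Union>n. F n)"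
    using assms by (simp_all only: filtration_exhaustive)
  then obtain k l where "x \<in> F k" "y \<in> F l"
    by (elim UN_E)
  then show thesis
    using that[of "max k l"] filtration_le[of k "max k l"] filtration_le[of l "max k l"] by auto
qed

text \<open>By connectedness a left factor is \<open>r \<cdot> 1\<close>, and the scalar moves to
  the right factor: \<open>r1 \<otimes> b = 1 \<otimes> rb\<close>. Since
  \<open>\<epsilon> 1 = 1\<close>, applying \<open>counit_lift\<close> recovers that right factor,
  so the second component is given by an additive map of \<open>z\<close>.\<close>

lemma tensor_image_F0:
  assumes "z \<in> tensor_image R H H (F 0) (F n)"
  shows "z = pure_tensor R H H \<one>\<^bsub>H\<^esub> (counit_lift z)"
proof -
  have "(\<lambda>z. z) z = (\<lambda>z. pure_tensor R H H \<one>\<^bsub>H\<^esub> (counit_lift z)) z"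
  proof (rule HH.tensor_image_hom_ext[OF filtration_submodule filtration_submodule _ _ _ assms])
    show "abelian_group_hom HH HH (\<lambda>z. z)"
      by (simp add: abelian_group_homI HH.tensor_product_abelian_group)
    have "abelian_group_hom H HH (pure_tensor R H H \<one>\<^bsub>H\<^esub>)"
      using HH.pure_tensor_balanced one_H_closed
      by (intro abelian_group_homI HH.tensor_product_abelian_group H_abelian_group)
        (auto simp: balanced_maps_def)
    then show "abelian_group_hom HH HH (\<lambda>z. pure_tensor R H H \<one>\<^bsub>H\<^esub> (counit_lift z))"
      by (rule abelian_group_hom_compose[OF counit_lift_hom])
    fix a b assume a: "a \<in> F 0" and b: "b \<in> F n"
    obtain r where r: "r \<in> carrier R" "a = r \<odot>\<^bsub>H\<^esub> \<one>\<^bsub>H\<^esub>"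
      using a by (auto simp: connected unit_map_def)
    have "counit_lift (pure_tensor R H H a b) = r \<odot>\<^bsub>H\<^esub> b"
      using r b filtration_closed one_H_closed
      by (simp add: counit_lift_pure counit_smult counit_one)
    then show "pure_tensor R H H a b
        = pure_tensor R H H \<one>\<^bsub>H\<^esub> (counit_lift (pure_tensor R H H a b))"
      using r b filtration_closed one_H_closed HH.pure_tensor_balanced
      by (simp add: balanced_maps_def)
  qed
  then show ?thesis .
qed

text \<open>The last clause expresses that \<open>v\<close> is a sum of tensors with right factors
  of degree below \<open>n\<close>, in the form in which this is applied: additive maps into
  \<open>H\<close> that agree on all such pure tensors agree at \<open>v\<close>.\<close>

lemma coproduct_decomposition:
  assumes x: "x \<in> F n"
  obtains y v where "y \<in> carrier H" "v \<in> carrier HH"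
    "\<Delta> x = pure_tensor R H H \<one>\<^bsub>H\<^esub> y \<oplus>\<^bsub>HH\<^esub> v"
    "\<forall>f g. abelian_group_hom HH H f \<longrightarrow> abelian_group_hom HH H g \<longrightarrow>
      (\<forall>m<n. \<forall>a\<in>carrier H. \<forall>b\<in>F m.
        f (pure_tensor R H H a b) = g (pure_tensor R H H a b)) \<longrightarrow> f v = g v"
proof -
  interpret T: abelian_group HH by (rule HH.tensor_product_abelian_group)
  note sub = filtration_submodule
  obtain u t where u: "u \<in> tensor_image R H H (F 0) (F n)"
    and t: "t \<in> (\<Pi> p\<in>{0<..<n}. tensor_image R H H (F p) (F (n - p)))"
    and \<Delta>: "\<Delta> x = u \<oplus>\<^bsub>HH\<^esub> (\<Oplus>\<^bsub>HH\<^esub>p\<in>{0<..<n}. t p)"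
    using subsetD[OF filtration_coproduct imageI[OF x]] unfolding set_add_def' by blast
  have tc: "t \<in> {0<..<n} \<rightarrow> carrier HH"
    using t HH.tensor_image_subset[OF sub sub] by blast
  have "u \<in> carrier HH"
    using u HH.tensor_image_subset[OF sub sub] by blast
  then have "counit_lift u \<in> carrier H"
    by (rule abelian_group_hom.hom_closed[OF counit_lift_hom])
  moreover have "f (\<Oplus>\<^bsub>HH\<^esub>p\<in>{0<..<n}. t p) = g (\<Oplus>\<^bsub>HH\<^esub>p\<in>{0<..<n}. t p)"
    if f: "abelian_group_hom HH H f" and g: "abelian_group_hom HH H g"
      and eq: "\<forall>m<n. \<forall>a\<in>carrier H. \<forall>b\<in>F m.
        f (pure_tensor R H H a b) = g (pure_tensor R H H a b)" for f g
  proof (rule abelian_group_hom_finsum_cong[OF f g _ tc])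
    fix p assume p: "p \<in> {0<..<n}"
    then have tp: "t p \<in> tensor_image R H H (F p) (F (n - p))"
      using t by blast
    \<comment> \<open>Positivity of \<open>p\<close> makes the degree \<open>n - p\<close> of the
      right factor smaller than \<open>n\<close>.\<close>
    have "f (pure_tensor R H H a b) = g (pure_tensor R H H a b)"
      if "a \<in> F p" "b \<in> F (n - p)" for a b
      by (rule eq[rule_format, OF _ filtration_closed[OF that(1)] that(2)]) (use p in simp)
    then show "f (t p) = g (t p)"
      by (rule HH.tensor_image_hom_ext[OF sub sub f g _ tp])
  qed simp
  \<comment> \<open>The witness for \<open>y\<close> is \<open>counit_lift u\<close>, because
    \<open>u\<close>, having left factors in \<open>F 0\<close>, equals
    \<open>1 \<otimes> counit_lift u\<close>.\<close>
  ultimately show thesis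
    using T.finsum_closed[OF tc] \<Delta>
    by (intro that[of "counit_lift u" "\<Oplus>\<^bsub>HH\<^esub>p\<in>{0<..<n}. t p"])
      (simp_all flip: tensor_image_F0[OF u])
qed

text \<open>Both \<open>f x\<close> and the summand \<open>1 \<cdot> f y\<close> of
  \<open>mult_lift f (\<Delta> x)\<close> may involve \<open>f\<close> in degree \<open>n\<close>.
  As \<open>x\<close> and \<open>y\<close> differ by \<open>counit_lift v\<close>, these
  contributions cancel in the difference, and what remains evaluates \<open>f\<close> only in lower
  degrees.\<close>

lemma mult_lift_coproduct_cong:
  assumes f: "f \<in> linear_maps R H H" and g: "g \<in> linear_maps R H H" and x: "x \<in> F n"
    and eq: "\<And>m b. m < n \<Longrightarrow> b \<in> F m \<Longrightarrow> f b = g b"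
  shows "mult_lift f (\<Delta> x) \<ominus>\<^bsub>H\<^esub> f x = mult_lift g (\<Delta> x) \<ominus>\<^bsub>H\<^esub> g x"
proof -
  obtain y v where y: "y \<in> carrier H" and v: "v \<in> carrier HH"
    and \<Delta>: "\<Delta> x = pure_tensor R H H \<one>\<^bsub>H\<^esub> y \<oplus>\<^bsub>HH\<^esub> v"
    and ext: "\<forall>f g. abelian_group_hom HH H f \<longrightarrow> abelian_group_hom HH H g \<longrightarrow>
      (\<forall>m<n. \<forall>a\<in>carrier H. \<forall>b\<in>F m.
        f (pure_tensor R H H a b) = g (pure_tensor R H H a b)) \<longrightarrow> f v = g v"
    by (rule coproduct_decomposition[OF x])
  interpret c: abelian_group_hom HH H counit_lift by (rule counit_lift_hom)
  have "x = counit_lift (\<Delta> x)"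
    using x by (simp add: counit_lift_coproduct filtration_closed)
  also have "\<dots> = y \<oplus>\<^bsub>H\<^esub> counit_lift v"
    using y v one_H_closed by (simp add: \<Delta> counit_lift_pure counit_one)
  finally have xy: "x = y \<oplus>\<^bsub>H\<^esub> counit_lift v" .
  \<comment> \<open>The common term \<open>h y\<close> drops out, which leaves an expression in
    \<open>v\<close> alone.\<close>
  have diff: "mult_lift h (\<Delta> x) \<ominus>\<^bsub>H\<^esub> h x = mult_lift h v \<ominus>\<^bsub>H\<^esub> h (counit_lift v)"
    if h: "h \<in> linear_maps R H H" for h
  proof -
    interpret m: abelian_group_hom HH H "mult_lift h" by (rule mult_lift_hom[OF h])
    interpret h: abelian_group_hom H H h by (rule linear_hom[OF h])
    have "mult_lift h (\<Delta> x) = h y \<oplus>\<^bsub>H\<^esub> mult_lift h v"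
      using y v one_H_closed by (simp add: \<Delta> mult_lift_pure[OF h])
    moreover have "h x = h y \<oplus>\<^bsub>H\<^esub> h (counit_lift v)"
      using y v by (subst xy) simp
    moreover have "(p \<oplus>\<^bsub>H\<^esub> q) \<ominus>\<^bsub>H\<^esub> (p \<oplus>\<^bsub>H\<^esub> s) = q \<ominus>\<^bsub>H\<^esub> s"
      if "p \<in> carrier H" "q \<in> carrier H" "s \<in> carrier H" for p q s
      using that
      by (simp add: M.minus_eq M.minus_add M.a_comm[of p q] M.a_assoc M.r_neg1 M.r_neg2)
    ultimately show ?thesis
      using y v by simp
  qed
  have "mult_lift f v = mult_lift g v"
    by (rule ext[rule_format, OF mult_lift_hom[OF f] mult_lift_hom[OF g]])
      (use eq filtration_closed in \<open>simp add: mult_lift_pure f g\<close>)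
  moreover have "f (counit_lift v) = g (counit_lift v)"
  proof (rule ext[rule_format, OF abelian_group_hom_compose[OF counit_lift_hom linear_hom[OF f]]
        abelian_group_hom_compose[OF counit_lift_hom linear_hom[OF g]]])
    fix m a b assume "m < n" "a \<in> carrier H" "b \<in> F m"
    \<comment> \<open>The contraction of a pure tensor by the counit keeps the degree of its right
      factor, since \<open>F m\<close> is a submodule.\<close>
    moreover from this have "\<epsilon> a \<odot>\<^bsub>H\<^esub> b \<in> F m"
      by (intro submodule.smult_closed[OF filtration_submodule] counit_closed)
    ultimately show "f (counit_lift (pure_tensor R H H a b)) = g (counit_lift (pure_tensor R H H a b))"
      using eq filtration_closed by (simp add: counit_lift_pure)
  qed
  ultimately show ?thesis
    by (simp add: diff f g)
qed

text \<open>Strong induction on the degree: once \<open>f\<close> and \<open>g\<close> agree below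
  \<open>n\<close>, the differences of convolution and map agree on \<open>F n\<close>. Both
  convolutions equal \<open>\<epsilon> x \<cdot> 1\<close>, so the maps themselves agree.\<close>

lemma right_antipode_unique:
  assumes "right_antipode R H \<Delta> \<epsilon> f" "right_antipode R H \<Delta> \<epsilon> g" and x: "x \<in> carrier H"
  shows "f x = g x"
proof -
  have f: "f \<in> linear_maps R H H" and g: "g \<in> linear_maps R H H"
    using assms by (auto simp: right_antipode_def)
  have "\<forall>x\<in>F n. f x = g x" for n
  proof (induction n rule: less_induct)
    case (less n)
    show ?case
    proof
      fix x assume "x \<in> F n"
      then have x: "x \<in> carrier H" by (rule filtration_closed)
      have "mult_lift f (\<Delta> x) \<ominus>\<^bsub>H\<^esub> f x = mult_lift g (\<Delta> x) \<ominus>\<^bsub>H\<^esub> g x"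
        using less by (intro mult_lift_coproduct_cong[OF f g \<open>x \<in> F n\<close>]) blast
      moreover have "mult_lift f (\<Delta> x) = \<epsilon> x \<odot>\<^bsub>H\<^esub> \<one>\<^bsub>H\<^esub>" "mult_lift g (\<Delta> x) = \<epsilon> x \<odot>\<^bsub>H\<^esub> \<one>\<^bsub>H\<^esub>"
        using assms x by (simp_all add: right_antipode_iff f g)
      ultimately have "\<ominus>\<^bsub>H\<^esub> f x = \<ominus>\<^bsub>H\<^esub> g x"
        using x linear_closed[OF f] linear_closed[OF g] counit_closed one_H_closed
        by (simp add: M.minus_eq)
      then show "f x = g x"
        using x linear_closed[OF f] linear_closed[OF g] by (metis M.minus_minus)
    qed
  qed
  with x filtration_exhaustive show ?thesis by blast
qed

section \<open>Construction of the antipode by iteration\<close>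

definition antipode_step :: "('a \<Rightarrow> 'a) \<Rightarrow> 'a \<Rightarrow> 'a"
  where "antipode_step f x = \<epsilon> x \<odot>\<^bsub>H\<^esub> \<one>\<^bsub>H\<^esub> \<ominus>\<^bsub>H\<^esub> (mult_lift f (\<Delta> x) \<ominus>\<^bsub>H\<^esub> f x)"

text \<open>The lift \<open>mult_lift f\<close> is well defined when \<open>f\<close> is linear, so
  linearity has to survive each step. All three terms are linear in \<open>x\<close>.\<close>

lemma antipode_step_linear:
  assumes f: "f \<in> linear_maps R H H"
  shows "antipode_step f \<in> linear_maps R H H"
proof -
  have diff: "(\<lambda>x. g x \<ominus>\<^bsub>H\<^esub> h x) \<in> linear_maps R H H"
    if "g \<in> linear_maps R H H" "h \<in> linear_maps R H H" for g h
    using that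
    by (auto simp: linear_maps_def Pi_iff M.minus_eq M.minus_add M.a_ac smult_r_distr smult_r_minus)
  have "(\<lambda>x. \<epsilon> x \<odot>\<^bsub>H\<^esub> \<one>\<^bsub>H\<^esub>) \<in> linear_maps R H H"
    using one_H_closed
    by (auto simp: linear_maps_def counit_closed counit_add counit_smult smult_l_distr smult_assoc1)
  from diff[OF this diff[OF convolution_id_linear[OF f] f]] show ?thesis
    by (simp add: antipode_step_def[abs_def])
qed

definition antipode_iter :: "nat \<Rightarrow> 'a \<Rightarrow> 'a"
  where "antipode_iter n = (antipode_step ^^ n) (\<lambda>_. \<zero>\<^bsub>H\<^esub>)"

lemma antipode_iter_linear: "antipode_iter n \<in> linear_maps R H H"
proof (induction n)
  case 0
  show ?case
    by (auto simp: antipode_iter_def linear_maps_def)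
next
  case (Suc n)
  then show ?case
    using antipode_step_linear by (simp add: antipode_iter_def)
qed

lemma antipode_iter_Suc: "antipode_iter (Suc n) = antipode_step (antipode_iter n)"
  by (simp add: antipode_iter_def)

text \<open>One more step at an element of \<open>F n\<close> consults the previous iterate only in
  degrees below \<open>n\<close>, where it has already stabilised. Degree \<open>n\<close> becomes
  stable at \<open>n + 1\<close> rather than \<open>n\<close>, since the zero map need not be
  correct even on \<open>F 0\<close>.\<close>

lemma antipode_iter_stable: "x \<in> F n \<Longrightarrow> n < i \<Longrightarrow> antipode_iter i x = antipode_iter (Suc n) x"
proof (induction n arbitrary: x i rule: less_induct)
  case (less n)
  obtain j where j: "i = Suc j" "n \<le> j"
    using less.prems(2) by (cases i) auto
  \<comment> \<open>Both \<open>j\<close> and \<open>n\<close> exceed \<open>m\<close>, so the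
    induction hypothesis identifies either value with that of iterate \<open>m + 1\<close>.\<close>
  have "antipode_iter j b = antipode_iter n b" if "m < n" "b \<in> F m" for m b
    using less.IH[OF that, of j] less.IH[OF that, of n] that j by simp
  then have "mult_lift (antipode_iter j) (\<Delta> x) \<ominus>\<^bsub>H\<^esub> antipode_iter j x
      = mult_lift (antipode_iter n) (\<Delta> x) \<ominus>\<^bsub>H\<^esub> antipode_iter n x"
    by (rule mult_lift_coproduct_cong[OF antipode_iter_linear antipode_iter_linear less.prems(1)])
  then show ?case
    unfolding j antipode_iter_Suc antipode_step_def by (rule arg_cong)
qed

lemma right_antipode_exists: "\<exists>S\<in>extensional (carrier H). right_antipode R H \<Delta> \<epsilon> S"
proof -
  \<comment> \<open>The limit of the iterates: \<open>Suc\<close> selects the first iterate known to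
    be stable in the least degree of \<open>x\<close>. Restriction to the carrier puts the map in
    the class in which it is unique as a function.\<close>
  define S where "S = restrict (\<lambda>x. antipode_iter (Suc (LEAST n. x \<in> F n)) x) (carrier H)"
  have S_eq: "S x = antipode_iter i x" if "x \<in> F n" "n < i" for x n i
  proof -
    let ?l = "LEAST n. x \<in> F n"
    have "x \<in> F ?l" "?l \<le> n"
      using that(1) by (auto intro: LeastI Least_le)
    then show ?thesis
      using that antipode_iter_stable[of x ?l i] filtration_closed by (simp add: S_def)
  qed
  \<comment> \<open>On each \<open>F n\<close> the map \<open>S\<close> coincides with the linear
    iterate \<open>n + 1\<close>. Any two elements lie in a common \<open>F n\<close>, which also
    contains their sum and multiples.\<close>
  have S: "S \<in> linear_maps R H H"
    unfolding linear_maps_def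
  proof (safe)
    fix x assume "x \<in> carrier H"
    then show "S x \<in> carrier H"
      by (simp add: S_def linear_closed[OF antipode_iter_linear])
  next
    fix x y assume xy: "x \<in> carrier H" "y \<in> carrier H"
    then obtain n where n: "x \<in> F n" "y \<in> F n"
      by (rule filtration_directed)
    then have "x \<oplus>\<^bsub>H\<^esub> y \<in> F n"
      by (rule submoduleE(5)[OF filtration_submodule])
    with n xy show "S (x \<oplus>\<^bsub>H\<^esub> y) = S x \<oplus>\<^bsub>H\<^esub> S y"
      using antipode_iter_linear[of "Suc n"] by (simp add: S_eq[of _ n "Suc n"] linear_maps_def)
  next
    fix r x assume rx: "r \<in> carrier R" "x \<in> carrier H"
    obtain n where n: "x \<in> F n"
      by (rule filtration_directed[OF rx(2) rx(2)])
    then have "r \<odot>\<^bsub>H\<^esub> x \<in> F n"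
      using rx(1) by (intro submodule.smult_closed[OF filtration_submodule])
    with n rx show "S (r \<odot>\<^bsub>H\<^esub> x) = r \<odot>\<^bsub>H\<^esub> S x"
      using antipode_iter_linear[of "Suc n"] by (simp add: S_eq[of _ n "Suc n"] linear_maps_def)
  qed
  have "mult_lift S (\<Delta> x) = \<epsilon> x \<odot>\<^bsub>H\<^esub> \<one>\<^bsub>H\<^esub>" if x: "x \<in> carrier H" for x
  proof -
    obtain n where n: "x \<in> F n"
      by (rule filtration_directed[OF x x])
    let ?d = "mult_lift S (\<Delta> x) \<ominus>\<^bsub>H\<^esub> S x"
    have "?d = mult_lift (antipode_iter (Suc n)) (\<Delta> x) \<ominus>\<^bsub>H\<^esub> antipode_iter (Suc n) x"
      by (rule mult_lift_coproduct_cong[OF S antipode_iter_linear n]) (rule S_eq, assumption, simp)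
    \<comment> \<open>Reading \<open>S x\<close> as iterate \<open>n + 2\<close>, that is, as one
      step applied to iterate \<open>n + 1\<close>, turns stability into a fixed-point
      equation.\<close>
    then have fixpoint: "S x = \<epsilon> x \<odot>\<^bsub>H\<^esub> \<one>\<^bsub>H\<^esub> \<ominus>\<^bsub>H\<^esub> ?d"
      using S_eq[OF n, of "Suc (Suc n)"] by (simp add: antipode_iter_Suc[of "Suc n"] antipode_step_def)
    \<comment> \<open>With \<open>p\<close> the convolution at \<open>x\<close>, \<open>q\<close>
      the element \<open>\<epsilon> x \<cdot> 1\<close> and \<open>s\<close> the value
      \<open>S x\<close>, cancelling \<open>s\<close> in the fixed-point equation gives the antipode
      equation.\<close>
    have "p = q" if "s = q \<ominus>\<^bsub>H\<^esub> (p \<ominus>\<^bsub>H\<^esub> s)" "p \<in> carrier H" "q \<in> carrier H" "s \<in> carrier H"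
      for p q s
    proof -
      have "\<zero>\<^bsub>H\<^esub> \<oplus>\<^bsub>H\<^esub> s = (q \<ominus>\<^bsub>H\<^esub> p) \<oplus>\<^bsub>H\<^esub> s"
        using that by (simp add: M.minus_eq M.minus_add M.a_assoc)
      then have "\<zero>\<^bsub>H\<^esub> = q \<ominus>\<^bsub>H\<^esub> p"
        using that(2-4) by (subst (asm) M.add.right_cancel) simp_all
      then show ?thesis
        using that(2,3) M.minus_equality[of q "\<ominus>\<^bsub>H\<^esub> p"] by (simp add: M.minus_eq)
    qed
    from this[OF fixpoint] show ?thesis
      using x linear_closed[OF S] linear_closed[OF convolution_id_linear[OF S]] counit_closed one_H_closed
      by simp
  qed
  with S have "right_antipode R H \<Delta> \<epsilon> S"
    by (simp add: right_antipode_iff)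
  moreover have "S \<in> extensional (carrier H)"
    by (simp add: S_def)
  ultimately show ?thesis by blast
qed

end

theorem proposition4p5:
  fixes R :: "('r, 's) ring_scheme"
    and H :: "('r, 'a, 'm) module_scheme"
    and \<Delta> :: "'a \<Rightarrow> ('a \<times> 'a \<Rightarrow>\<^sub>0 int) set"
    and \<epsilon> :: "'a \<Rightarrow> 'r"
    and P :: "'a \<Rightarrow> 'a"
    and F :: "nat \<Rightarrow> 'a set"
  assumes "connected_filtered_left_counital_operated_bialgebra R H \<Delta> \<epsilon> P F"
  shows "left_counital_Hopf_algebra R H \<Delta> \<epsilon> P
    \<and> (\<exists>!S. S \<in> extensional (carrier H) \<and> S \<in> linear_maps R H H \<and> antipode_recursion R H \<Delta> \<epsilon> S)
    \<and> (\<forall>S. S \<in> linear_maps R H H \<and> antipode_recursion R H \<Delta> \<epsilon> S \<longrightarrow> right_antipode R H \<Delta> \<epsilon> S)"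
proof -
  interpret connected_filtered_left_counital_operated_bialgebra R H \<Delta> \<epsilon> P F by fact
  have iff: "S \<in> linear_maps R H H \<and> antipode_recursion R H \<Delta> \<epsilon> S \<longleftrightarrow> right_antipode R H \<Delta> \<epsilon> S" for S
    using antipode_recursion_iff by (auto simp: right_antipode_def)
  obtain S where S: "S \<in> extensional (carrier H)" "right_antipode R H \<Delta> \<epsilon> S"
    using right_antipode_exists by blast
  \<comment> \<open>Right antipodes agree on the carrier; extensional maps are also fixed outside
    it, so they are equal as functions.\<close>
  have "\<exists>!S. S \<in> extensional (carrier H) \<and> right_antipode R H \<Delta> \<epsilon> S"
    using S by (blast intro: extensionalityI right_antipode_unique)
  moreover have "left_counital_Hopf_algebra R H \<Delta> \<epsilon> P"
    using S left_counital_operated_bialgebra_axioms by (auto simp: left_counital_Hopf_algebra_def)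
  ultimately show ?thesis
    by (simp add: iff)
qed

end
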